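(* Consider the robust remanufacturing planning model with Kullback–Leibler-distance-based ambiguity sets $\mathcal{U}_{sk}=\{\pmb p\in\Delta(\mathcal{S}): D(\pmb p\,\|\,\hat{\pmb p}(\cdot|s,k))\le\theta\}$, $(s,k)\in\mathcal{S}\times\mathcal{K}$, under the standing assumptions (T) and (R) given in the context. Then there exist a cumulative number of completed remanufacturing activities $k^\ast\in\mathcal{K}$ and, for each $k\in\mathcal{K}$, an operational state $s_k\in\mathcal{S}$ such that the optimal robust policy $a(s,k)$ satisfies: for $k<k^\ast$, $$a(s,k)=\begin{cases}0 & \text{if } s<s_k,\\ 1 & \text{if } s\ge s_k,\end{cases}$$ and for $k\ge k^\ast$, $$a(s,k)=\begin{cases}0 & \text{if } s<s_k,\\ 2 & \text{if } s\ge s_k.\end{cases}$$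
   Context: Model. $\mathcal{S}=\{0,1,\dots,S\}$ is the set of conditions of a component (larger is worse), $\mathcal{K}=\{0,1,2,\dots\}$ is the set of cumulative numbers of completed remanufacturing activities, and $\mathcal{A}=\{0,1,2\}$ is the set of actions ($0$: continue operation, $1$: remanufacture, $2$: scrap). The one-period reward of operating is $r(s,k)=g(s,k)-e(s,k)$, where $g$ is the operational gain and $e$ the environmental (carbon) cost; $c_{\rm r}$ is the remanufacturing cost, $c_{\rm s}$ the salvage value, $\beta\in(0,1)$ the discount factor. Under action $0$ the component at $(s,k)$ moves to $(s',k)$ with probability $p(s'|s,k)$; deterioration is irreversible ($p(s'|s,k)=0$ for $s'<s$), and $S$ is absorbing under action $0$. $\Delta(\mathcal{S})$ denotes the set of probability vectors on $\mathcal{S}$. The row $\pmb p(\cdot|s,k)$ is only known to lie in an ambiguity set $\mathcal{U}_{sk}$, and the overall ambiguity set is the product $\bigotimes_{s,k}\mathcal{U}_{sk}$ (rectangularity). The value function $V$ satisfies $$V(s,k)=\max_{a\in\mathcal{A}}w(s,k;a),$$ $$w(s,k;0)=\inf_{\pmb p(\cdot|s,k)\in\mathcal{U}_{sk}}\Big\{r(s,k)+\beta\sum_{s'\in\mathcal{S}}p(s'|s,k)V(s',k)\Big\},\quad w(s,k;1)=-c_{\rm r}+\beta V(0,k+1),\quad w(s,k;2)=c_{\rm s},$$ and is the limit of robust value iteration (iterating the right-hand side starting from the zero function). The optimal robust policy is $a(s,k)\in\arg\max_{a\in\mathcal{A}}w(s,k;a)$. KL distance. $\hat{\pmb p}(\cdot|s,k)$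 is the nominal (empirical) transition distribution, $\hat{\pmb P}(\cdot|\cdot,k)=[\hat p(s'|s,k)]$ is the nominal transition matrix (subject to the same irreversibility and absorption), $D(\pmb p\|\hat{\pmb p})=\sum_{s'}p(s')\log\frac{p(s')}{\hat p(s')}$ (with $0\log 0=0$, and $D=\infty$ if $p(s')>0=\hat p(s')$ for some $s'$), and $\theta>0$ is the radius. Stochastic orders. A transition matrix $[p(i|j)]_{i,j=0,\dots,n}$ ($j$ current state, $i$ next state) is IFR if $\sum_{i=m}^n p(i|j)$ is non-decreasing in $j$ for every $m$. $\pmb P_1\succeq\pmb P_2$ means $\sum_{i=m}^n p_1(i|j)\ge\sum_{i=m}^n p_2(i|j)$ for all $j,m$. Standing assumptions. (T) For every $k\in\mathcal{K}$, $\hat{\pmb P}(\cdot|\cdot,k)$ is IFR and $\hat{\pmb P}(\cdot|\cdot,k+1)\succeq\hat{\pmb P}(\cdot|\cdot,k)$. (R) $g(s,k)$ is non-increasing in $s$ and in $k$; $e(s,k)$ is non-decreasing in $s$ and in $k$; and $\frac{r(S,0)}{1-\beta}<c_{\rm s}$.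
   Formalization: k* may be infinite, but only if remanufacturing is strictly better than scrapping at every (s,k), where no k* in K can exist (e.g. S=1, g(0,k)=10, g(1,k)=0, e=0, c_r=c_s=1, β=0.9); ties in the argmax are read as: some optimal robust policy has this form. *)

theory Defs
  imports "HOL-Library.Extended_Real" "HOL-Library.Extended_Nat"
begin

section \<open>Probability vectors, Kullback--Leibler balls, and stochastic orders\<close>

text \<open>
  A vector on the condition set \<open>{0..S}\<close> is a function \<open>nat \<Rightarrow> real\<close> of which only the
  entries at indices \<open>\<le> S\<close> are ever used.
\<close>

definition prob_vectors :: "nat \<Rightarrow> (nat \<Rightarrow> real) set" where
  "prob_vectors S = {p. (\<forall>s\<le>S. 0 \<le> p s) \<and> (\<Sum>s\<le>S. p s) = 1}"

text \<open>The convention \<open>0 log 0 = 0\<close> holds because \<open>0 * x = 0\<close>.\<close>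

definition kl_dist :: "nat \<Rightarrow> (nat \<Rightarrow> real) \<Rightarrow> (nat \<Rightarrow> real) \<Rightarrow> ereal" where
  "kl_dist S p q =
     (if \<exists>s\<le>S. p s > 0 \<and> q s = 0 then \<infinity>
      else ereal (\<Sum>s\<le>S. p s * ln (p s / q s)))"

definition kl_ball :: "nat \<Rightarrow> real \<Rightarrow> (nat \<Rightarrow> real) \<Rightarrow> (nat \<Rightarrow> real) set" where
  "kl_ball S \<theta> q = {p \<in> prob_vectors S. kl_dist S p q \<le> ereal \<theta>}"

text \<open>
  A transition matrix \<open>P\<close> is written with the current state first: \<open>P j i\<close> is the
  probability \<open>p(i|j)\<close> of moving from \<open>j\<close> to \<open>i\<close>.
\<close>

definition IFR :: "nat \<Rightarrow> (nat \<Rightarrow> nat \<Rightarrow> real) \<Rightarrow> bool" where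
  "IFR n P \<longleftrightarrow> (\<forall>m\<le>n. mono_on {0..n} (\<lambda>j. \<Sum>i=m..n. P j i))"

definition stoch_dominates ::
    "nat \<Rightarrow> (nat \<Rightarrow> nat \<Rightarrow> real) \<Rightarrow> (nat \<Rightarrow> nat \<Rightarrow> real) \<Rightarrow> bool" where
  "stoch_dominates n P1 P2 \<longleftrightarrow> (\<forall>j\<le>n. \<forall>m\<le>n. (\<Sum>i=m..n. P1 j i) \<ge> (\<Sum>i=m..n. P2 j i))"

section \<open>The robust remanufacturing model\<close>

datatype action = Continue | Remanufacture | Scrap

text \<open>
  In the following, \<open>U s k\<close> is the ambiguity set of the transition row at \<open>(s, k)\<close>.
  Rectangularity is expressed by minimising over each row separately.
\<close>

definition robust_q ::
    "nat \<Rightarrow> real \<Rightarrow> (nat \<Rightarrow> nat \<Rightarrow> real) \<Rightarrow> real \<Rightarrow> real \<Rightarrow> (nat \<Rightarrow> nat \<Rightarrow> (nat \<Rightarrow> real) set)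
      \<Rightarrow> (nat \<Rightarrow> nat \<Rightarrow> real) \<Rightarrow> nat \<Rightarrow> nat \<Rightarrow> action \<Rightarrow> real" where
  "robust_q S \<beta> r cr cs U V s k a =
     (case a of
        Continue \<Rightarrow> (INF p\<in>U s k. r s k + \<beta> * (\<Sum>s'\<le>S. p s' * V s' k))
      | Remanufacture \<Rightarrow> - cr + \<beta> * V 0 (k + 1)
      | Scrap \<Rightarrow> cs)"

definition robust_bellman ::
    "nat \<Rightarrow> real \<Rightarrow> (nat \<Rightarrow> nat \<Rightarrow> real) \<Rightarrow> real \<Rightarrow> real \<Rightarrow> (nat \<Rightarrow> nat \<Rightarrow> (nat \<Rightarrow> real) set)
      \<Rightarrow> (nat \<Rightarrow> nat \<Rightarrow> real) \<Rightarrow> nat \<Rightarrow> nat \<Rightarrow> real" where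
  "robust_bellman S \<beta> r cr cs U V s k =
     (MAX a\<in>{Continue, Remanufacture, Scrap}. robust_q S \<beta> r cr cs U V s k a)"

definition robust_value_iteration ::
    "nat \<Rightarrow> real \<Rightarrow> (nat \<Rightarrow> nat \<Rightarrow> real) \<Rightarrow> real \<Rightarrow> real \<Rightarrow> (nat \<Rightarrow> nat \<Rightarrow> (nat \<Rightarrow> real) set)
      \<Rightarrow> nat \<Rightarrow> nat \<Rightarrow> nat \<Rightarrow> real" where
  "robust_value_iteration S \<beta> r cr cs U n =
     (robust_bellman S \<beta> r cr cs U ^^ n) (\<lambda>s k. 0)"

definition is_robust_value_function ::
    "nat \<Rightarrow> real \<Rightarrow> (nat \<Rightarrow> nat \<Rightarrow> real) \<Rightarrow> real \<Rightarrow> real \<Rightarrow> (nat \<Rightarrow> nat \<Rightarrow> (nat \<Rightarrow> real) set)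
      \<Rightarrow> (nat \<Rightarrow> nat \<Rightarrow> real) \<Rightarrow> bool" where
  "is_robust_value_function S \<beta> r cr cs U V \<longleftrightarrow>
     (\<forall>s\<le>S. \<forall>k. V s k = robust_bellman S \<beta> r cr cs U V s k) \<and>
     (\<forall>s\<le>S. \<forall>k. (\<lambda>n. robust_value_iteration S \<beta> r cr cs U n s k) \<longlonglongrightarrow> V s k)"

definition is_optimal_robust_policy ::
    "nat \<Rightarrow> real \<Rightarrow> (nat \<Rightarrow> nat \<Rightarrow> real) \<Rightarrow> real \<Rightarrow> real \<Rightarrow> (nat \<Rightarrow> nat \<Rightarrow> (nat \<Rightarrow> real) set)
      \<Rightarrow> (nat \<Rightarrow> nat \<Rightarrow> real) \<Rightarrow> (nat \<Rightarrow> nat \<Rightarrow> action) \<Rightarrow> bool" where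
  "is_optimal_robust_policy S \<beta> r cr cs U V a \<longleftrightarrow>
     (\<forall>s\<le>S. \<forall>k. is_arg_max (robust_q S \<beta> r cr cs U V s k) (\<lambda>_. True) (a s k))"

end

theory Submission
  imports Defs
begin

text \<open>
  If \<open>q'\<close> stochastically dominates \<open>q\<close>, the monotone coupling transports any \<open>p\<close> in the
  Kullback--Leibler ball around \<open>q\<close> upwards to some \<open>p'\<close>, and by the log-sum inequality \<open>p'\<close>
  lies in the ball of the same radius around \<open>q'\<close>. So worst-case expectations of non-increasing
  functions decrease in the stochastic order of the nominal distribution, and robust value
  iteration, hence \<open>V\<close>, is non-increasing in both arguments. Therefore continuing
  loses value in \<open>s\<close> while the other two actions do not depend on \<open>s\<close>, and remanufacturing loses
  value in \<open>k\<close> while scrapping does not depend on \<open>k\<close>. In state \<open>S\<close> continuing forever is worth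
  less than \<open>cs\<close>, so the threshold never exceeds \<open>S\<close>.
\<close>

section \<open>Log-sum inequality and monotone coupling\<close>

text \<open>Writing the numerators as \<open>w i * m i\<close> builds in absolute continuity, so a
  vanishing \<open>m i\<close> needs no separate case. The bound is the termwise estimate
  \<open>ln x \<le> x - 1\<close>, summed.\<close>

lemma log_sum_inequality:
  fixes w m :: "'i \<Rightarrow> real"
  assumes "finite I" and w: "\<And>i. i \<in> I \<Longrightarrow> 0 \<le> w i" and m: "\<And>i. i \<in> I \<Longrightarrow> 0 \<le> m i"
  shows "(\<Sum>i\<in>I. w i * m i) * ln ((\<Sum>i\<in>I. w i * m i) / (\<Sum>i\<in>I. m i))
           \<le> (\<Sum>i\<in>I. w i * m i * ln (w i))"
proof -
  define A where "A = (\<Sum>i\<in>I. w i * m i)"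
  define B where "B = (\<Sum>i\<in>I. m i)"
  have "0 \<le> A" unfolding A_def by (intro sum_nonneg mult_nonneg_nonneg w m)
  have "0 \<le> B" unfolding B_def by (intro sum_nonneg m)
  show ?thesis
  proof (cases "A = 0")
    case True
    then have "\<forall>i\<in>I. w i * m i = 0"
      unfolding A_def using assms by (subst (asm) sum_nonneg_eq_0_iff) auto
    then have "(\<Sum>i\<in>I. w i * m i * ln (w i)) = 0" by (intro sum.neutral) auto
    with True show ?thesis by (simp add: A_def)
  next
    case False
    then have "B \<noteq> 0"
      using assms unfolding A_def B_def by (auto simp: sum_nonneg_eq_0_iff)
    with False \<open>0 \<le> A\<close> \<open>0 \<le> B\<close> have pos: "0 < A" "0 < B" by auto
    define W where "W = A / B"
    have W: "0 < W" using pos by (simp add: W_def)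
    \<comment> \<open>Tangent bound at the overall ratio \<open>W\<close>. After summation the
      linear terms cancel because \<open>W * B = A\<close>, leaving \<open>A * ln W\<close>.\<close>
    have "w i * m i - W * m i + w i * m i * ln W \<le> w i * m i * ln (w i)" if "i \<in> I" for i
    proof (cases "w i = 0")
      case True
      then show ?thesis using W m[OF that] by simp
    next
      case False
      with w[OF that] have wi: "0 < w i" by simp
      have "ln W - ln (w i) \<le> W / w i - 1"
        using ln_le_minus_one[of "W / w i"] W wi by (simp add: ln_div)
      then have "w i * m i * (ln W - ln (w i)) \<le> w i * m i * (W / w i - 1)"
        using wi m[OF that] by (intro mult_left_mono) auto
      moreover have "w i * m i * (W / w i - 1) = W * m i - w i * m i"
        using wi by (simp add: field_simps)
      ultimately have "w i * m i * (ln W - ln (w i)) \<le> W * m i - w i * m i"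
        by (simp only:)
      then show ?thesis by (simp add: right_diff_distrib)
    qed
    then have "(\<Sum>i\<in>I. w i * m i - W * m i + w i * m i * ln W) \<le> (\<Sum>i\<in>I. w i * m i * ln (w i))"
      by (rule sum_mono)
    moreover have "(\<Sum>i\<in>I. w i * m i - W * m i + w i * m i * ln W) = A - W * B + A * ln W"
      by (simp add: sum.distrib sum_subtractf A_def B_def sum_distrib_left sum_distrib_right)
    moreover have "W * B = A" using pos by (simp add: W_def)
    ultimately show ?thesis by (simp add: A_def B_def W_def)
  qed
qed

text \<open>Quantile coupling: \<open>q\<close> and \<open>q'\<close> each cut the unit interval
  into consecutive pieces whose lengths are the masses, and \<open>\<pi> i j\<close> measures how
  far piece \<open>i\<close> of \<open>q\<close> overlaps piece \<open>j\<close> of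
  \<open>q'\<close>. Dominance shifts the cut points of \<open>q'\<close> to the left, so mass only
  travels upwards.\<close>

lemma monotone_coupling:
  assumes q: "q \<in> prob_vectors S" and q': "q' \<in> prob_vectors S"
    and dom: "\<And>m. m \<le> S \<Longrightarrow> (\<Sum>i=m..S. q i) \<le> (\<Sum>i=m..S. q' i)"
  obtains \<pi> :: "nat \<Rightarrow> nat \<Rightarrow> real"
  where "\<And>i j. i \<le> S \<Longrightarrow> j \<le> S \<Longrightarrow> 0 \<le> \<pi> i j"
    and "\<And>i. i \<le> S \<Longrightarrow> (\<Sum>j\<le>S. \<pi> i j) = q i"
    and "\<And>j. j \<le> S \<Longrightarrow> (\<Sum>i\<le>S. \<pi> i j) = q' j"
    and "\<And>i j. i \<le> S \<Longrightarrow> j < i \<Longrightarrow> \<pi> i j = 0"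
proof -
  define C where "C = (\<lambda>(q :: nat \<Rightarrow> real) i. \<Sum>l<i. q l)"
  define clamp :: "real \<Rightarrow> real \<Rightarrow> real \<Rightarrow> real" where "clamp = (\<lambda>a b x. max a (min b x))"
  have clamp_low: "clamp a b x = a" if "x \<le> a" for a b x
    using that by (auto simp: clamp_def)
  have clamp_high: "clamp a b x = b" if "a \<le> b" "b \<le> x" for a b x
    using that by (auto simp: clamp_def)
  have clamp_mono: "clamp a b x \<le> clamp a b y" if "x \<le> y" for a b x y
    unfolding clamp_def using that by (intro max.mono min.mono order_refl)
  \<comment> \<open>Both sides are the length of the intersection of \<open>[a, b]\<close> and
    \<open>[c, d]\<close>. This symmetry lets the column sums telescope just as the row sums
    do.\<close>
  have clamp_symm: "clamp a b d - clamp a b c = clamp c d b - clamp c d a"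
    if "a \<le> b" "c \<le> d" for a b c d
    using that unfolding clamp_def max_def min_def by (simp split: if_split)
  \<comment> \<open>the length of the overlap of the intervals \<open>[C q i, C q (i + 1)]\<close> and
    \<open>[C q' j, C q' (j + 1)]\<close>\<close>
  define \<pi> where
    "\<pi> = (\<lambda>i j. clamp (C q i) (C q (Suc i)) (C q' (Suc j)) - clamp (C q i) (C q (Suc i)) (C q' j))"
  have step: "C p i \<le> C p (Suc i)" "0 \<le> C p i" "C p i \<le> 1" "C p (Suc i) \<le> 1"
    if "p \<in> prob_vectors S" "i \<le> S" for p i
  proof -
    have nn: "0 \<le> p l" if "l \<le> S" for l
      using that \<open>p \<in> prob_vectors S\<close> by (simp add: prob_vectors_def)
    have one: "(\<Sum>l\<le>S. p l) = 1" using \<open>p \<in> prob_vectors S\<close> by (simp add: prob_vectors_def)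
    show 1: "C p i \<le> C p (Suc i)" using nn that by (simp add: C_def)
    show "0 \<le> C p i" using nn that by (auto simp: C_def intro!: sum_nonneg)
    show 2: "C p (Suc i) \<le> 1"
      unfolding C_def one[symmetric] using nn that by (intro sum_mono2) auto
    show "C p i \<le> 1" using 1 2 by simp
  qed
  have ends: "C p 0 = 0" "C p (Suc S) = 1" if "p \<in> prob_vectors S" for p
    using that by (simp_all add: C_def prob_vectors_def lessThan_Suc_atMost)
  \<comment> \<open>Tails and \<open>C\<close> add up to 1, so dominance of tails reverses into an
    inequality between cumulative sums.\<close>
  have cdf: "C q' i \<le> C q i" if "i \<le> S" for i
  proof -
    have "C p i = 1 - (\<Sum>l=i..S. p l)" if "p \<in> prob_vectors S" for p
    proof -
      have "(\<Sum>l\<le>S. p l) = C p i + (\<Sum>l=i..S. p l)"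
        unfolding C_def using \<open>i \<le> S\<close>
        by (subst sum.union_disjoint[symmetric]) (auto intro!: sum.cong)
      then show ?thesis using that by (simp add: prob_vectors_def)
    qed
    from this[OF q] this[OF q'] dom[OF that] show ?thesis by simp
  qed
  have symm: "\<pi> i j =
      clamp (C q' j) (C q' (Suc j)) (C q (Suc i)) - clamp (C q' j) (C q' (Suc j)) (C q i)"
    if "i \<le> S" "j \<le> S" for i j
    unfolding \<pi>_def by (intro clamp_symm step(1) q q' that)
  show ?thesis
  proof (rule that[of \<pi>])
    fix i j assume ij: "i \<le> S" "j \<le> S"
    show "0 \<le> \<pi> i j"
      unfolding \<pi>_def using clamp_mono[OF step(1)[OF q' ij(2)]] by simp
  next
    fix i assume i: "i \<le> S"
    have "(\<Sum>j\<le>S. \<pi> i j)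
        = clamp (C q i) (C q (Suc i)) (C q' (Suc S)) - clamp (C q i) (C q (Suc i)) (C q' 0)"
      unfolding \<pi>_def lessThan_Suc_atMost[symmetric] by (rule sum_lessThan_telescope)
    also have "\<dots> = C q (Suc i) - C q i"
      using step[OF q i] by (simp add: ends[OF q'] clamp_low clamp_high)
    finally show "(\<Sum>j\<le>S. \<pi> i j) = q i" by (simp add: C_def)
  next
    fix j assume j: "j \<le> S"
    have "(\<Sum>i\<le>S. \<pi> i j) = (\<Sum>i\<le>S. clamp (C q' j) (C q' (Suc j)) (C q (Suc i))
        - clamp (C q' j) (C q' (Suc j)) (C q i))"
      using j by (intro sum.cong) (auto simp: symm)
    also have "\<dots>
        = clamp (C q' j) (C q' (Suc j)) (C q (Suc S)) - clamp (C q' j) (C q' (Suc j)) (C q 0)"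
      unfolding lessThan_Suc_atMost[symmetric] by (rule sum_lessThan_telescope)
    also have "\<dots> = C q' (Suc j) - C q' j"
      using step[OF q' j] by (simp add: ends[OF q] clamp_low clamp_high)
    finally show "(\<Sum>i\<le>S. \<pi> i j) = q' j" by (simp add: C_def)
  next
    fix i j assume ij: "i \<le> S" "j < i"
    \<comment> \<open>Piece \<open>j\<close> of \<open>q'\<close> ends before piece \<open>i\<close>
      of \<open>q\<close> begins, so both clamps return the lower end and the overlap is
      empty.\<close>
    then have "C q' (Suc j) \<le> C q (Suc j)" by (intro cdf) simp
    also have "C q (Suc j) \<le> C q i"
      using ij q unfolding C_def by (intro sum_mono2) (auto simp: prob_vectors_def)
    finally have "C q' (Suc j) \<le> C q i" .
    moreover have "C q' j \<le> C q' (Suc j)" using ij by (intro step q') simp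
    ultimately show "\<pi> i j = 0"
      by (simp add: \<pi>_def clamp_low)
  qed
qed

section \<open>Kullback--Leibler balls and their transport\<close>

text \<open>A violation would make the divergence infinite. This justifies
  \<open>p i / q i * q i = p i\<close> even where \<open>q i = 0\<close>.\<close>

lemma kl_ball_absolutely_continuous:
  assumes "p \<in> kl_ball S \<theta> q" "i \<le> S" "q i = 0"
  shows "p i = 0"
proof (rule ccontr)
  assume "p i \<noteq> 0"
  moreover have "0 \<le> p i" using assms by (simp add: kl_ball_def prob_vectors_def)
  ultimately have "kl_dist S p q = \<infinity>"
    using assms by (auto simp: kl_dist_def intro!: exI[of _ i])
  then show False using assms by (simp add: kl_ball_def)
qed

text \<open>Supplies the nonemptiness without which the infimum over the ball would be
  meaningless.\<close>

lemma kl_ball_center: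
  assumes "q \<in> prob_vectors S" "0 \<le> \<theta>"
  shows "q \<in> kl_ball S \<theta> q"
proof -
  have "(\<Sum>s\<le>S. q s * ln (q s / q s)) = 0"
    by (rule sum.neutral) auto
  then show ?thesis using assms by (simp add: kl_ball_def kl_dist_def)
qed

text \<open>Data processing inequality: the kernel \<open>\<pi> i j / q i\<close> sends
  \<open>q\<close> to \<open>q'\<close> and \<open>p\<close> to the new vector, and pushing both
  through one kernel cannot increase the divergence.\<close>

lemma kl_ball_transport:
  assumes q: "q \<in> prob_vectors S" and p: "p \<in> kl_ball S \<theta> q"
    and nonneg: "\<And>i j. i \<le> S \<Longrightarrow> j \<le> S \<Longrightarrow> 0 \<le> \<pi> i j"
    and left: "\<And>i. i \<le> S \<Longrightarrow> (\<Sum>j\<le>S. \<pi> i j) = q i"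
    and right: "\<And>j. j \<le> S \<Longrightarrow> (\<Sum>i\<le>S. \<pi> i j) = q' j"
  shows "(\<lambda>j. \<Sum>i\<le>S. p i / q i * \<pi> i j) \<in> kl_ball S \<theta> q'"
proof -
  define w where "w = (\<lambda>i. p i / q i)"
  define p' where "p' = (\<lambda>j. \<Sum>i\<le>S. w i * \<pi> i j)"
  have w: "0 \<le> w i" if "i \<le> S" for i
    using that p q by (simp add: w_def kl_ball_def prob_vectors_def)
  have wq: "w i * q i = p i" if "i \<le> S" for i
    using kl_ball_absolutely_continuous[OF p that] by (simp add: w_def)
  have rows: "(\<Sum>j\<le>S. w i * \<pi> i j) = p i" if "i \<le> S" for i
    by (simp only: sum_distrib_left[symmetric] left[OF that] wq[OF that])
  have "(\<Sum>j\<le>S. p' j) = (\<Sum>i\<le>S. p i)"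
    unfolding p'_def by (subst sum.swap) (simp add: rows)
  then have p'_prob: "p' \<in> prob_vectors S"
    using p w nonneg by (auto simp: prob_vectors_def kl_ball_def p'_def intro!: sum_nonneg)
  \<comment> \<open>A column of \<open>\<pi>\<close> with sum 0 vanishes, so \<open>p'\<close> puts
    no mass where \<open>q'\<close> has none and \<open>kl_dist\<close> takes its finite
    branch.\<close>
  have p'_ac: "p' j = 0" if "j \<le> S" "q' j = 0" for j
  proof -
    have "(\<Sum>i\<le>S. \<pi> i j) = 0" using that right by simp
    then have "\<forall>i\<le>S. \<pi> i j = 0"
      using nonneg that by (subst (asm) sum_nonneg_eq_0_iff) auto
    then show ?thesis by (simp add: p'_def)
  qed
  \<comment> \<open>The log-sum inequality is applied to each column of \<open>\<pi>\<close>;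
    exchanging the sums and using the row sums then recovers the divergence of \<open>p\<close> from
    \<open>q\<close>.\<close>
  have "(\<Sum>j\<le>S. p' j * ln (p' j / q' j)) \<le> (\<Sum>j\<le>S. \<Sum>i\<le>S. w i * \<pi> i j * ln (w i))"
  proof (rule sum_mono)
    fix j assume "j \<in> {..S}"
    then show "p' j * ln (p' j / q' j) \<le> (\<Sum>i\<le>S. w i * \<pi> i j * ln (w i))"
      using log_sum_inequality[of "{..S}" w "\<lambda>i. \<pi> i j"] w nonneg right by (simp add: p'_def)
  qed
  also have "\<dots> = (\<Sum>i\<le>S. p i * ln (p i / q i))"
    by (subst sum.swap)
      (simp add: sum_distrib_right[symmetric] rows, simp add: w_def)
  also have "\<dots> \<le> \<theta>"
    using p by (auto simp: kl_ball_def kl_dist_def split: if_splits)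
  finally have "p' \<in> kl_ball S \<theta> q'"
    using p'_prob p'_ac by (auto simp: kl_ball_def kl_dist_def)
  then show ?thesis by (simp add: p'_def w_def)
qed

section \<open>Worst-case expectations and the stochastic order\<close>

text \<open>An expectation is at least the minimum of \<open>v\<close>. Real infima are only
  conditionally complete, so comparing them requires this bound.\<close>

lemma bdd_below_expectation:
  assumes "P \<subseteq> prob_vectors S" "0 \<le> \<beta>"
  shows "bdd_below ((\<lambda>p. c + \<beta> * (\<Sum>s\<le>S. p s * v s)) ` P)"
proof (rule bdd_belowI2)
  fix p assume "p \<in> P"
  then have p: "\<And>s. s \<le> S \<Longrightarrow> 0 \<le> p s" "(\<Sum>s\<le>S. p s) = 1"
    using assms by (auto simp: prob_vectors_def)
  have "Min (v ` {..S}) = (\<Sum>s\<le>S. p s * Min (v ` {..S}))"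
    by (simp add: sum_distrib_right[symmetric] p)
  also have "\<dots> \<le> (\<Sum>s\<le>S. p s * v s)"
    using p by (intro sum_mono mult_left_mono) auto
  finally show "c + \<beta> * Min (v ` {..S}) \<le> c + \<beta> * (\<Sum>s\<le>S. p s * v s)"
    using assms by (simp add: mult_left_mono)
qed

text \<open>Every \<open>p\<close> in the ball around \<open>q\<close> is matched by a transported
  \<open>p'\<close> around \<open>q'\<close> with no larger value. The hypothesis on
  \<open>v\<close> and \<open>v'\<close> combines antitonicity with pointwise comparison, so that
  the two sides may belong to different \<open>k\<close>.\<close>

lemma kl_worst_case_antimono:
  assumes q: "q \<in> prob_vectors S" and q': "q' \<in> prob_vectors S" and "0 \<le> \<theta>" "0 \<le> \<beta>"
    and dom: "\<And>m. m \<le> S \<Longrightarrow> (\<Sum>i=m..S. q i) \<le> (\<Sum>i=m..S. q' i)"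
    and v: "\<And>i j. i \<le> j \<Longrightarrow> j \<le> S \<Longrightarrow> v' j \<le> v i" and c: "c' \<le> (c :: real)"
  shows "(INF p\<in>kl_ball S \<theta> q'. c' + \<beta> * (\<Sum>s\<le>S. p s * v' s))
       \<le> (INF p\<in>kl_ball S \<theta> q. c + \<beta> * (\<Sum>s\<le>S. p s * v s))"
proof (rule cINF_mono)
  show "kl_ball S \<theta> q \<noteq> {}" using kl_ball_center[OF q \<open>0 \<le> \<theta>\<close>] by auto
  show "bdd_below ((\<lambda>p. c' + \<beta> * (\<Sum>s\<le>S. p s * v' s)) ` kl_ball S \<theta> q')"
    using \<open>0 \<le> \<beta>\<close> by (intro bdd_below_expectation) (auto simp: kl_ball_def)
next
  fix p assume p: "p \<in> kl_ball S \<theta> q"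
  obtain \<pi> where nonneg: "\<And>i j. i \<le> S \<Longrightarrow> j \<le> S \<Longrightarrow> 0 \<le> \<pi> i j"
    and left: "\<And>i. i \<le> S \<Longrightarrow> (\<Sum>j\<le>S. \<pi> i j) = q i"
    and right: "\<And>j. j \<le> S \<Longrightarrow> (\<Sum>i\<le>S. \<pi> i j) = q' j"
    and upward: "\<And>i j. i \<le> S \<Longrightarrow> j < i \<Longrightarrow> \<pi> i j = 0"
    using monotone_coupling[OF q q' dom] by metis
  define p' where "p' = (\<lambda>j. \<Sum>i\<le>S. p i / q i * \<pi> i j)"
  have "p' \<in> kl_ball S \<theta> q'"
    unfolding p'_def by (rule kl_ball_transport[OF q p nonneg left right])
  moreover have "(\<Sum>j\<le>S. p' j * v' j) \<le> (\<Sum>i\<le>S. p i * v i)"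
  proof -
    have "(\<Sum>j\<le>S. p' j * v' j) = (\<Sum>i\<le>S. \<Sum>j\<le>S. p i / q i * \<pi> i j * v' j)"
      unfolding p'_def sum_distrib_right by (rule sum.swap)
    \<comment> \<open>Mass moves only from \<open>i\<close> to some \<open>j\<close> with
      \<open>i \<le> j\<close>, where \<open>v' j \<le> v i\<close>.\<close>
    also have "\<dots> \<le> (\<Sum>i\<le>S. \<Sum>j\<le>S. p i / q i * \<pi> i j * v i)"
    proof (intro sum_mono)
      fix i j assume ij: "i \<in> {..S}" "j \<in> {..S}"
      have "0 \<le> p i / q i * \<pi> i j"
        using ij p q nonneg by (auto simp: kl_ball_def prob_vectors_def)
      then show "p i / q i * \<pi> i j * v' j \<le> p i / q i * \<pi> i j * v i"
        using ij upward[of i j] v[of i j] by (cases "j < i") (simp, intro mult_left_mono, simp_all)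
    qed
    also have "\<dots> = (\<Sum>i\<le>S. p i / q i * (\<Sum>j\<le>S. \<pi> i j) * v i)"
      by (simp add: sum_distrib_left sum_distrib_right)
    also have "\<dots> = (\<Sum>i\<le>S. p i * v i)"
      using kl_ball_absolutely_continuous[OF p] by (intro sum.cong) (auto simp: left)
    finally show ?thesis .
  qed
  ultimately show "\<exists>p'\<in>kl_ball S \<theta> q'.
      c' + \<beta> * (\<Sum>s\<le>S. p' s * v' s) \<le> c + \<beta> * (\<Sum>s\<le>S. p s * v s)"
    using c \<open>0 \<le> \<beta>\<close> by (intro bexI[of _ p']) (auto intro!: add_mono mult_left_mono)
qed

section \<open>Monotonicity of the model and of its value function\<close>

text \<open>The path goes through \<open>P k t\<close>: IFR changes the state at fixed
  \<open>k\<close>, then dominance is iterated from \<open>k\<close> to \<open>l\<close>.\<close>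

lemma nominal_tail_mono:
  fixes P :: "nat \<Rightarrow> nat \<Rightarrow> nat \<Rightarrow> real"
  assumes T_IFR: "\<And>k. IFR S (P k)" and T_dom: "\<And>k. stoch_dominates S (P (k + 1)) (P k)"
    and "s \<le> t" "t \<le> S" "k \<le> l" "m \<le> S"
  shows "(\<Sum>i=m..S. P k s i) \<le> (\<Sum>i=m..S. P l t i)"
proof -
  have "(\<Sum>i=m..S. P k s i) \<le> (\<Sum>i=m..S. P k t i)"
    using T_IFR[of k] assms by (auto simp: IFR_def mono_on_def)
  also have "(\<Sum>i=m..S. P k t i) \<le> (\<Sum>i=m..S. P l t i)"
    by (rule lift_Suc_mono_le[of "\<lambda>k. \<Sum>i=m..S. P k t i"])
      (use assms in \<open>simp_all add: stoch_dominates_def\<close>)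
  finally show ?thesis .
qed

lemma robust_bellman_eq:
  "robust_bellman S \<beta> r cr cs U W s k =
     max (robust_q S \<beta> r cr cs U W s k Continue)
       (max (robust_q S \<beta> r cr cs U W s k Remanufacture) (robust_q S \<beta> r cr cs U W s k Scrap))"
  by (simp add: robust_bellman_def)

text \<open>Joint antitonicity in both arguments, shared by rewards, iterates and the limit.
  Conditions above \<open>S\<close> are left unconstrained, as they carry no meaning.\<close>

definition antitone_value :: "nat \<Rightarrow> (nat \<Rightarrow> nat \<Rightarrow> real) \<Rightarrow> bool" where
  "antitone_value S W \<longleftrightarrow> (\<forall>s t k l. s \<le> t \<longrightarrow> t \<le> S \<longrightarrow> k \<le> l \<longrightarrow> W t l \<le> W s k)"

locale kl_remanufacturing =
  fixes S :: nat and r :: "nat \<Rightarrow> nat \<Rightarrow> real" and cr cs \<beta> \<theta> :: real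
    and phat :: "nat \<Rightarrow> nat \<Rightarrow> nat \<Rightarrow> real"
  assumes \<beta>: "0 \<le> \<beta>" and \<theta>: "0 \<le> \<theta>"
    and r: "antitone_value S r"
    and nominal: "\<And>k s. s \<le> S \<Longrightarrow> phat k s \<in> prob_vectors S"
    and T_IFR: "\<And>k. IFR S (phat k)"
    and T_dom: "\<And>k. stoch_dominates S (phat (k + 1)) (phat k)"
begin

abbreviation "klq \<equiv> robust_q S \<beta> r cr cs (\<lambda>s k. kl_ball S \<theta> (phat k s))"

text \<open>For \<open>Continue\<close>, the reward, the nominal law and the future values all
  worsen together. \<open>Remanufacture\<close> resets the condition, so only the larger
  \<open>k\<close> counts; \<open>Scrap\<close> is constant.\<close>

lemma robust_q_antimono:
  assumes W: "antitone_value S W" and "s \<le> t" "t \<le> S" "k \<le> l"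
  shows "klq W t l a \<le> klq W s k a"
proof (cases a)
  case Continue
  have "(INF p\<in>kl_ball S \<theta> (phat l t). r t l + \<beta> * (\<Sum>s'\<le>S. p s' * W s' l))
      \<le> (INF p\<in>kl_ball S \<theta> (phat k s). r s k + \<beta> * (\<Sum>s'\<le>S. p s' * W s' k))"
    using assms r \<beta> \<theta> unfolding antitone_value_def
    by (intro kl_worst_case_antimono nominal nominal_tail_mono[of S phat, OF T_IFR T_dom]) auto
  then show ?thesis by (simp add: robust_q_def Continue)
next
  case Remanufacture
  then show ?thesis
    using assms \<beta> by (auto simp: robust_q_def antitone_value_def intro!: mult_left_mono)
qed (simp add: robust_q_def)

text \<open>The zero function is antitone, and a maximum of antitone action values is again
  antitone.\<close>

lemma robust_value_iteration_antimono:
  "antitone_value S (robust_value_iteration S \<beta> r cr cs (\<lambda>s k. kl_ball S \<theta> (phat k s)) n)"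
proof (induction n)
  case 0
  then show ?case by (simp add: antitone_value_def robust_value_iteration_def)
next
  case (Suc n)
  let ?W = "robust_value_iteration S \<beta> r cr cs (\<lambda>s k. kl_ball S \<theta> (phat k s)) n"
  have "robust_bellman S \<beta> r cr cs (\<lambda>s k. kl_ball S \<theta> (phat k s)) ?W t l
      \<le> robust_bellman S \<beta> r cr cs (\<lambda>s k. kl_ball S \<theta> (phat k s)) ?W s k"
    if "s \<le> t" "t \<le> S" "k \<le> l" for s t k l
    unfolding robust_bellman_eq using that by (intro max.mono robust_q_antimono Suc)
  then show ?case by (simp add: antitone_value_def robust_value_iteration_def)
qed

text \<open>Weak inequalities survive the pointwise limit of value iteration.\<close>

lemma robust_value_function_antimono:
  assumes "is_robust_value_function S \<beta> r cr cs (\<lambda>s k. kl_ball S \<theta> (phat k s)) V"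
  shows "antitone_value S V"
  unfolding antitone_value_def
proof (intro allI impI)
  fix s t k l :: nat assume le: "s \<le> t" "t \<le> S" "k \<le> l"
  let ?W = "robust_value_iteration S \<beta> r cr cs (\<lambda>s k. kl_ball S \<theta> (phat k s))"
  have "(\<lambda>n. ?W n t l) \<longlonglongrightarrow> V t l" "(\<lambda>n. ?W n s k) \<longlonglongrightarrow> V s k"
    using assms le by (auto simp: is_robust_value_function_def)
  then show "V t l \<le> V s k"
    using le robust_value_iteration_antimono
    by (intro LIMSEQ_le[of "\<lambda>n. ?W n t l" _ "\<lambda>n. ?W n s k"])
      (auto simp: antitone_value_def)
qed

text \<open>By absolute continuity the ball around a point mass contains only that point mass, so
  there is no ambiguity in state \<open>S\<close>.\<close>

lemma robust_q_absorbing: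
  assumes "\<And>s. s < S \<Longrightarrow> phat k S s = 0"
  shows "klq W S k Continue = r S k + \<beta> * W S k"
proof -
  have "(\<Sum>s\<le>S. p s * W s k) = W S k" if p: "p \<in> kl_ball S \<theta> (phat k S)" for p
  proof -
    have 0: "p s = 0" if "s < S" for s
      using kl_ball_absolutely_continuous[OF p, of s] assms that by simp
    have sum: "(\<Sum>s\<le>S. p s * u s) = p S * u S" for u :: "nat \<Rightarrow> real"
      unfolding lessThan_Suc_atMost[symmetric] by (simp add: 0)
    have "p S = 1"
      using sum[of "\<lambda>_. 1"] p by (simp add: kl_ball_def prob_vectors_def)
    then show ?thesis by (simp add: sum)
  qed
  moreover have "kl_ball S \<theta> (phat k S) \<noteq> {}"
    using kl_ball_center[OF nominal \<theta>] by blast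
  ultimately show ?thesis by (simp add: robust_q_def)
qed

end

section \<open>Thresholds and the optimal policy\<close>

theorem theorem1:
  fixes S :: nat
    and g e r :: "nat \<Rightarrow> nat \<Rightarrow> real"
    and cr cs \<beta> \<theta> :: real
    and phat :: "nat \<Rightarrow> nat \<Rightarrow> nat \<Rightarrow> real"
    and U :: "nat \<Rightarrow> nat \<Rightarrow> (nat \<Rightarrow> real) set"
    and V :: "nat \<Rightarrow> nat \<Rightarrow> real"
  assumes discount: "0 < \<beta>" "\<beta> < 1"
    and radius: "\<theta> > 0"
    and reward: "r = (\<lambda>s k. g s k - e s k)"
    and nominal: "\<And>k s. s \<le> S \<Longrightarrow> phat k s \<in> prob_vectors S"
    and irreversible: "\<And>k s s'. s \<le> S \<Longrightarrow> s' < s \<Longrightarrow> phat k s s' = 0"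
    and absorbing: "\<And>k. phat k S S = 1"
    and T_IFR: "\<And>k. IFR S (phat k)"
    and T_dom: "\<And>k. stoch_dominates S (phat (k + 1)) (phat k)"
    and g_mono_s: "\<And>k. antimono_on {0..S} (\<lambda>s. g s k)"
    and g_mono_k: "\<And>s. s \<le> S \<Longrightarrow> antimono (\<lambda>k. g s k)"
    and e_mono_s: "\<And>k. mono_on {0..S} (\<lambda>s. e s k)"
    and e_mono_k: "\<And>s. s \<le> S \<Longrightarrow> mono (\<lambda>k. e s k)"
    and salvage: "r S 0 / (1 - \<beta>) < cs"
    and ambiguity: "U = (\<lambda>s k. kl_ball S \<theta> (phat k s))"
    and value_function: "is_robust_value_function S \<beta> r cr cs U V"
  shows "\<exists>(kstar :: enat) (sk :: nat \<Rightarrow> nat) (a :: nat \<Rightarrow> nat \<Rightarrow> action).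
           is_optimal_robust_policy S \<beta> r cr cs U V a \<and>
           (\<forall>k. sk k \<le> S) \<and>
           (\<forall>k s. enat k < kstar \<and> s \<le> S \<longrightarrow>
              a s k = (if s < sk k then Continue else Remanufacture)) \<and>
           (\<forall>k s. enat k \<ge> kstar \<and> s \<le> S \<longrightarrow>
              a s k = (if s < sk k then Continue else Scrap)) \<and>
           (kstar = \<infinity> \<longrightarrow>
              (\<forall>k. \<forall>s\<le>S. robust_q S \<beta> r cr cs U V s k Scrap
                         < robust_q S \<beta> r cr cs U V s k Remanufacture))"
proof -
  let ?q = "robust_q S \<beta> r cr cs U V"
  have "antitone_value S r"
    unfolding antitone_value_def
  proof (intro allI impI)
    fix s t k l :: nat assume le: "s \<le> t" "t \<le> S" "k \<le> l"
    have "g t l \<le> g t k" "g t k \<le> g s k" "e s k \<le> e t k" "e t k \<le> e t l"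
      using le g_mono_k[of t] g_mono_s[of k] e_mono_k[of t] e_mono_s[of k]
      by (auto simp: monotone_on_def)
    then show "r t l \<le> r s k" by (simp add: reward)
  qed
  note r = this
  interpret kl_remanufacturing S r cr cs \<beta> \<theta> phat
    using discount radius r nominal T_IFR T_dom by unfold_locales auto
  have V: "antitone_value S V"
    using robust_value_function_antimono[OF value_function[unfolded ambiguity]] .
  have q_mono: "?q t l b \<le> ?q s k b" if "s \<le> t" "t \<le> S" "k \<le> l" for s t k l b
    using robust_q_antimono[OF V that] by (simp add: ambiguity)
  have V_eq: "V s k = robust_bellman S \<beta> r cr cs U V s k" if "s \<le> S" for s k
    using value_function that by (simp add: is_robust_value_function_def)

  define M where "M = (\<lambda>k. - cr + \<beta> * V 0 (k + 1))"
  have q_M: "?q s k Remanufacture = M k" and q_cs: "?q s k Scrap = cs" for s k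
    by (simp_all add: robust_q_def M_def)
  have M_mono: "M l \<le> M k" if "k \<le> l" for k l
    using q_mono[of 0 0 k l Remanufacture] that by (simp add: q_M)

  \<comment> \<open>If continuing were strictly best in \<open>S\<close>, the fixed-point equation
    would read \<open>V S k = r S k + \<beta> * V S k\<close>. Solving it gives a value below
    \<open>cs\<close>, although \<open>V S k\<close> exceeds \<open>cs\<close>.\<close>
  have last: "?q S k Continue \<le> max (M k) cs" for k
  proof (rule ccontr)
    assume "\<not> ?thesis"
    then have V_S: "V S k = ?q S k Continue" and less: "cs < V S k"
      using V_eq[of S k] by (auto simp: robust_bellman_eq q_M q_cs)
    have "?q S k Continue = r S k + \<beta> * V S k"
      unfolding ambiguity by (intro robust_q_absorbing) (auto simp: irreversible)
    with V_S have "V S k = r S k / (1 - \<beta>)"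
      using discount by (simp add: field_simps)
    also have "\<dots> \<le> r S 0 / (1 - \<beta>)"
      using r discount by (intro divide_right_mono) (auto simp: antitone_value_def)
    finally show False using salvage less by simp
  qed

  \<comment> \<open>Ties go against \<open>Continue\<close>. By \<open>last\<close> the minimum is
    taken over a set containing \<open>S\<close>.\<close>
  define sk where "sk = (\<lambda>k. LEAST s. ?q s k Continue \<le> max (M k) cs)"
  \<comment> \<open>The value \<infinity> covers the case in which remanufacturing always strictly
    beats scrapping; a tie \<open>M k = cs\<close> counts as scrapping.\<close>
  define kstar where "kstar = (if \<exists>k. M k \<le> cs then enat (LEAST k. M k \<le> cs) else \<infinity>)"
  define a where "a = (\<lambda>s k. if s < sk k then Continue
      else if enat k < kstar then Remanufacture else Scrap)"
  have sk_le: "sk k \<le> S" for k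
    unfolding sk_def by (rule Least_le) (rule last)
  have below: "max (M k) cs < ?q s k Continue" if "s < sk k" for s k
    using not_less_Least[OF that[unfolded sk_def]] by (simp only: not_le)
  have above: "?q s k Continue \<le> max (M k) cs" if "sk k \<le> s" "s \<le> S" for s k
  proof -
    have "?q (sk k) k Continue \<le> max (M k) cs"
      unfolding sk_def by (rule LeastI) (rule last)
    then show ?thesis using q_mono[OF that order_refl, where b = Continue] by (rule order_trans[rotated])
  qed
  have before: "cs < M k" if "enat k < kstar" for k
    using that not_less_Least[of k "\<lambda>k. M k \<le> cs"]
    by (auto simp: kstar_def not_le split: if_splits)
  have after: "M k \<le> cs" if "\<not> enat k < kstar" for k
  proof -
    from that have ex: "\<exists>k. M k \<le> cs" and le: "(LEAST k. M k \<le> cs) \<le> k"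
      by (auto simp: kstar_def split: if_splits)
    from M_mono[OF le] LeastI_ex[OF ex] show ?thesis by (rule order_trans)
  qed

  have "?q s k b \<le> ?q s k (a s k)" if "s \<le> S" for s k b
  proof -
    have "?q s k b \<le> max (?q s k Continue) (max (M k) cs)"
      by (cases b) (auto simp: q_M q_cs)
    also have "\<dots> = ?q s k (a s k)"
      using below[of s k] above[of k s] before[of k] after[of k] that
      by (auto simp: a_def q_M q_cs max_def)
    finally show ?thesis .
  qed
  then have "is_optimal_robust_policy S \<beta> r cr cs U V a"
    by (auto simp: is_optimal_robust_policy_def is_arg_max_linorder)
  then show ?thesis
    using sk_le before
    by (intro exI[of _ kstar] exI[of _ sk] exI[of _ a]) (auto simp: a_def q_M q_cs)
qed

end
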